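(* For a natural number $n$, let $\rho(n)=|\mathcal{X}'_n|/|\mathcal{X}_n|$ be the proportion of Dirichlet characters modulo $n$ that are primitive, and let $\omega(n)$ be the number of distinct prime divisors of $n$. For $k\ge 1$ let $n_k$ be the product of the first $k$ primes. Then for every integer $k>1$ and every natural number $n$ with $n\not\equiv 2\pmod 4$ and $\omega(n)=k$, one has $$\rho(2n_k)\log\log(2n_k)\le\rho(n)\log\log n.$$
   Context: $\mathcal{X}_n$ is the set of all Dirichlet characters modulo $n$, and $\mathcal{X}'_n\subseteq\mathcal{X}_n$ is the subset of primitive characters (those whose conductor equals $n$). *)

theory Defs
  imports Complex_Main "HOL-Library.Infinite_Set" "HOL-Number_Theory.Number_Theory"
begin

text \<open>
  A Dirichlet character modulo \<open>n\<close>, as a function on the integers: completely multiplicative,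
  \<open>n\<close>-periodic and vanishing exactly off the units modulo \<open>n\<close>. The normalisation \<open>\<chi> 1 = 1\<close>
  follows, since \<open>\<chi> 1\<close> is a nonzero idempotent.
\<close>
definition dirichlet_character :: "nat \<Rightarrow> (int \<Rightarrow> complex) \<Rightarrow> bool" where
  "dirichlet_character n \<chi> \<longleftrightarrow>
     (\<forall>a b. \<chi> (a * b) = \<chi> a * \<chi> b) \<and>
     (\<forall>a. \<chi> (a + int n) = \<chi> a) \<and>
     (\<forall>a. \<chi> a = 0 \<longleftrightarrow> \<not> coprime a (int n))"

definition dirichlet_characters :: "nat \<Rightarrow> (int \<Rightarrow> complex) set" where
  "dirichlet_characters n = {\<chi>. dirichlet_character n \<chi>}"

text \<open>
  The character \<open>\<chi>\<close> modulo \<open>n\<close> is induced by the character \<open>\<psi>\<close> if the two agree on the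
  integers coprime to \<open>n\<close>; they may differ elsewhere, because \<open>\<psi>\<close> need not vanish there.
\<close>
definition induced_by :: "nat \<Rightarrow> (int \<Rightarrow> complex) \<Rightarrow> (int \<Rightarrow> complex) \<Rightarrow> bool" where
  "induced_by n \<chi> \<psi> \<longleftrightarrow> (\<forall>a. coprime a (int n) \<longrightarrow> \<chi> a = \<psi> a)"

definition conductor :: "nat \<Rightarrow> (int \<Rightarrow> complex) \<Rightarrow> nat" where
  "conductor n \<chi> =
     (LEAST d. d dvd n \<and> (\<exists>\<psi>\<in>dirichlet_characters d. induced_by n \<chi> \<psi>))"

definition primitive_characters :: "nat \<Rightarrow> (int \<Rightarrow> complex) set" where
  "primitive_characters n = {\<chi> \<in> dirichlet_characters n. conductor n \<chi> = n}"

definition primitive_proportion :: "nat \<Rightarrow> real" where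
  "primitive_proportion n =
     real (card (primitive_characters n)) / real (card (dirichlet_characters n))"

definition prime_omega :: "nat \<Rightarrow> nat" where
  "prime_omega n = card (prime_factors n)"

definition primorial :: "nat \<Rightarrow> nat" where
  "primorial k = (\<Prod>i<k. enumerate {p. prime p} i)"

end

theory Submission
  imports Defs
begin

text \<open>
  For a divisor \<open>d\<close> of \<open>n\<close> let \<open>K d\<close> be the group of units modulo \<open>n\<close> that are 1 modulo \<open>d\<close>.
  The characters modulo \<open>n\<close> trivial on \<open>K d\<close> are the ones induced from \<open>d\<close>; there are \<open>totient d\<close>
  of them, because a finite abelian group has as many characters as elements. A character modulo
  \<open>n\<close> is primitive iff it is nontrivial on \<open>K (n div p)\<close> for every prime \<open>p\<close> dividing \<open>n\<close>. These
  subgroups are independent, so that the proportion of primitive characters is the product over \<open>p\<close>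
  of \<open>1 - 1 / card (K (n div p))\<close>, where the group has \<open>p\<close> elements if \<open>p\<^sup>2\<close> divides \<open>n\<close> and
  \<open>p - 1\<close> otherwise. For \<open>n \<noteq> 2\<close> modulo 4 each factor is bounded below by a function that is
  monotone on the primes and whose product over the first \<open>k\<close> primes is the proportion for
  \<open>2 * primorial k\<close>. As also \<open>n \<ge> 2 * primorial k\<close>, both factors of the product in the theorem
  can be compared separately.
\<close>

section \<open>Characters of finite abelian groups\<close>

text \<open>Extensionality makes a character depend only on its values on \<open>H\<close>, so that
  characters can be counted. The value 1 at the identity follows from nonvanishing.\<close>

definition (in group) characters :: "'a set \<Rightarrow> ('a \<Rightarrow> complex) set" where
  "characters H = {f \<in> extensional H. (\<forall>x\<in>H. f x \<noteq> 0) \<and> (\<forall>x\<in>H. \<forall>y\<in>H. f (x \<otimes> y) = f x * f y)}"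

lemma (in group) character_one:
  assumes "subgroup H G" and "f \<in> characters H"
  shows "f \<one> = 1"
proof -
  have "f (\<one> \<otimes> \<one>) = f \<one> * f \<one>" "f \<one> \<noteq> 0"
    using assms subgroup.one_closed[OF assms(1)] unfolding characters_def by blast+
  then show ?thesis by simp
qed

lemma (in group) character_pow:
  assumes "subgroup H G" and "f \<in> characters H" and "x \<in> H"
  shows "f (x [^] (k::nat)) = f x ^ k"
proof (induction k)
  case 0
  then show ?case using character_one[OF assms(1,2)] by simp
next
  case (Suc k)
  have "x [^] k \<in> H"
    using assms(1,3) by (induction k) (auto simp: subgroup.one_closed subgroup.m_closed)
  then have "f (x [^] k \<otimes> x) = f (x [^] k) * f x"
    using assms unfolding characters_def by blast
  then show ?case using Suc by simp
qed

text \<open>If \<open>m\<close> is least with \<open>a [^] m \<in> H\<close>, a character \<open>f\<close> of \<open>H\<close> extends to the group generated by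
  \<open>H\<close> and \<open>a\<close> in exactly \<open>m\<close> ways, one for each \<open>m\<close>-th root of \<open>f (a [^] m)\<close>.\<close>
lemma (in comm_group) adjoin_element:
  assumes fin: "finite (carrier G)" and H: "subgroup H G" and a: "a \<in> carrier G"
    and IH: "finite (characters H)" "card (characters H) = card H"
  obtains H' where "subgroup H' G" "insert a H \<subseteq> H'"
    "finite (characters H')" "card (characters H') = card H'"
proof -
  note sub [simp] = subgroup.mem_carrier[OF H]
  note one_H [simp] = subgroup.one_closed[OF H]
  note mult_H [simp] = subgroup.m_closed[OF H]
  note inv_H [simp] = subgroup.m_inv_closed[OF H]
  note a [simp]
  have pow_H [simp]: "x [^] k \<in> H" if "x \<in> H" for x and k :: nat
    using that by (induction k) auto
  define m :: nat where "m = (LEAST m. 0 < m \<and> a [^] m \<in> H)"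
  have "0 < ord a \<and> a [^] ord a \<in> H"
    using fin a ord_ge_1[of a] pow_ord_eq_1[OF a] by auto
  then have m: "0 < m" "a [^] m \<in> H"
    unfolding m_def by (rule LeastI2; simp)+
  have m_le: "m \<le> i" if "0 < i" "a [^] i \<in> H" for i
    unfolding m_def using that by (intro Least_le) simp
  have cancel: "a [^] j \<in> H" if "h \<in> H" "h \<otimes> a [^] j \<in> H" for h and j :: nat
  proof -
    have "a [^] j = inv h \<otimes> (h \<otimes> a [^] j)"
      using that(1) by (simp add: m_assoc[symmetric])
    then show ?thesis using that by (metis mult_H inv_H)
  qed
  \<comment> \<open>Otherwise the power with exponent \<open>i mod m\<close> would lie in
    \<open>H\<close>, against the minimality of \<open>m\<close>.\<close>
  have dvd: "m dvd i" if "a [^] i \<in> H" for i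
  proof (rule ccontr)
    assume "\<not> m dvd i"
    then have r: "0 < i mod m" by (simp add: mod_greater_zero_iff_not_dvd)
    have "a [^] i = (a [^] m) [^] (i div m) \<otimes> a [^] (i mod m)"
      by (simp add: nat_pow_pow nat_pow_mult)
    then have "a [^] (i mod m) \<in> H"
      using cancel[of "(a [^] m) [^] (i div m)" "i mod m"] that m by simp
    from m_le[OF r this] show False using mod_less_divisor[OF m(1), of i] by simp
  qed
  \<comment> \<open>Cancelling the smaller power keeps all exponents natural; the case
    \<open>j \<le> i\<close> follows by symmetry wherever this is applied.\<close>
  have shift: "h = h' \<otimes> a [^] (j - i)" if "h \<in> H" "h' \<in> H" "h \<otimes> a [^] i = h' \<otimes> a [^] j" "i \<le> j"
    for h h' and i j :: nat
  proof -
    have "h \<otimes> a [^] i = (h' \<otimes> a [^] (j - i)) \<otimes> a [^] i"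
      using that by (simp add: m_assoc nat_pow_mult)
    then show ?thesis using that by simp
  qed
  \<comment> \<open>Natural exponents suffice: in a finite group the inverse of \<open>x\<close> is
    \<open>x [^] (ord x - 1)\<close>.\<close>
  define H' where "H' = (\<lambda>(h, i::nat). h \<otimes> a [^] i) ` (H \<times> UNIV)"
  have H'I: "h \<otimes> a [^] i \<in> H'" if "h \<in> H" for h and i :: nat
    unfolding H'_def using that by force
  have H'E: "\<exists>h i. h \<in> H \<and> x = h \<otimes> a [^] (i::nat)" if "x \<in> H'" for x
    using that unfolding H'_def by auto
  have sub_H': "H \<subseteq> H'"
  proof
    fix h assume "h \<in> H"
    then show "h \<in> H'" using H'I[of h 0] by simp
  qed
  have a_H': "a \<in> H'" using H'I[of \<one> 1] by simp
  have comb: "(h \<otimes> a [^] i) \<otimes> (h' \<otimes> a [^] j) = (h \<otimes> h') \<otimes> a [^] (i + j)"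
    if "h \<in> H" "h' \<in> H" for h h' and i j :: nat
    using that by (simp add: m_ac nat_pow_mult[symmetric])
  have mult: "x \<otimes> y \<in> H'" if xy: "x \<in> H'" "y \<in> H'" for x y
  proof -
    obtain h i where x: "h \<in> H" "x = h \<otimes> a [^] (i::nat)" using H'E[OF xy(1)] by blast
    obtain h' j where y: "h' \<in> H" "y = h' \<otimes> a [^] (j::nat)" using H'E[OF xy(2)] by blast
    show ?thesis unfolding x(2) y(2) comb[OF x(1) y(1)] using x y by (intro H'I) simp
  qed
  have "subgroup H' G"
  proof (rule subgroupI)
    show "H' \<subseteq> carrier G" using H'E by force
    show "H' \<noteq> {}" using a_H' by blast
    show "x \<otimes> y \<in> H'" if "x \<in> H'" "y \<in> H'" for x y using that by (rule mult)
    show "inv x \<in> H'" if "x \<in> H'" for x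
    proof -
      have x: "x \<in> carrier G" using that H'E by force
      have "x [^] k \<in> H'" for k :: nat
        using that mult sub_H' one_H by (induction k) auto
      moreover have "x [^] (ord x - 1) \<otimes> x = \<one>"
        using x ord_ge_1[OF fin x] pow_ord_eq_1[OF x] by (metis Suc_diff_1 nat_pow_Suc less_eq_Suc_le One_nat_def)
      ultimately show ?thesis using x by (metis inv_equality nat_pow_closed)
    qed
  qed
  moreover have "card H' = m * card H"
  proof -
    \<comment> \<open>Exponents can be reduced below \<open>m\<close>, and there the representation
      is unique, so \<open>H\<close> has index \<open>m\<close> in \<open>H'\<close>.\<close>
    have "bij_betw (\<lambda>(h, i). h \<otimes> a [^] i) (H \<times> {..<m}) H'"
      unfolding bij_betw_def
    proof
      show "inj_on (\<lambda>(h, i). h \<otimes> a [^] i) (H \<times> {..<m})"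
      proof (rule inj_onI, clarify)
        have *: "i = j \<and> h = h'" if "h \<in> H" "h' \<in> H" "i \<le> j" "j < m" "h \<otimes> a [^] i = h' \<otimes> a [^] j"
          for h h' i j
        proof -
          have h: "h = h' \<otimes> a [^] (j - i)" using shift that by blast
          then have "m dvd j - i" using that cancel dvd by blast
          then have "i = j" using that by (metis diff_diff_cancel diff_is_0_eq diff_le_self dvd_imp_le le_antisym le_less_trans not_le zero_less_diff)
          then show ?thesis using h that by simp
        qed
        fix h i h' j
        assume "h \<in> H" "h' \<in> H" "i < m" "j < m" "h \<otimes> a [^] i = h' \<otimes> a [^] j"
        then show "h = h' \<and> i = j" using *[of h h' i j] *[of h' h j i] by (cases "i \<le> j") auto
      qed
      show "(\<lambda>(h, i). h \<otimes> a [^] i) ` (H \<times> {..<m}) = H'"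
      proof
        show "H' \<subseteq> (\<lambda>(h, i). h \<otimes> a [^] i) ` (H \<times> {..<m})"
        proof
          fix x assume "x \<in> H'"
          then obtain h i where x: "h \<in> H" "x = h \<otimes> a [^] (i::nat)" using H'E by metis
          have "x = (h \<otimes> (a [^] m) [^] (i div m)) \<otimes> a [^] (i mod m)"
            using x by (simp add: nat_pow_pow nat_pow_mult m_assoc)
          moreover have "(h \<otimes> (a [^] m) [^] (i div m), i mod m) \<in> H \<times> {..<m}"
            using x m by simp
          ultimately show "x \<in> (\<lambda>(h, i). h \<otimes> a [^] i) ` (H \<times> {..<m})"
            by (metis (no_types, lifting) case_prod_conv imageI)
        qed
      qed (auto intro: H'I)
    qed
    then show ?thesis
      by (simp add: bij_betw_same_card[symmetric] card_cartesian_product)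
  qed
  moreover
  \<comment> \<open>A pair in \<open>R\<close> consists of a character of \<open>H\<close> and an
    admissible value of its extension at \<open>a\<close>.\<close>
  define R where "R = (SIGMA f : characters H. {z. z ^ m = f (a [^] m)})"
  \<comment> \<open>Two representations of one element have exponents differing by a multiple of
    \<open>m\<close>, and \<open>z ^ m = f (a [^] m)\<close> compensates for the difference. Hence
    the extension of \<open>f\<close> with value \<open>z\<close> at \<open>a\<close> is well
    defined.\<close>
  have wd: "f h * z ^ i = f h' * z ^ j"
    if "(f, z) \<in> R" "h \<in> H" "h' \<in> H" "h \<otimes> a [^] i = h' \<otimes> a [^] j"
    for f z h h' and i j :: nat
  proof -
    have *: "f h * z ^ i = f h' * z ^ j"
      if h: "h \<in> H" "h' \<in> H" "h \<otimes> a [^] i = h' \<otimes> a [^] j" "i \<le> j"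
      for h h' and i j :: nat
    proof -
      have f: "f \<in> characters H" and z: "z ^ m = f (a [^] m)" using \<open>(f, z) \<in> R\<close> by (auto simp: R_def)
      have e: "h = h' \<otimes> a [^] (j - i)" using shift h by blast
      then have pH: "a [^] (j - i) \<in> H" and "m dvd j - i" using h cancel dvd by blast+
      then obtain q where q: "j - i = m * q" by (auto simp: dvd_def)
      have "f h = f h' * f (a [^] (j - i))"
        using e f pH h(2) unfolding characters_def by blast
      also have "f (a [^] (j - i)) = f ((a [^] m) [^] q)"
        by (simp add: q nat_pow_pow)
      also have "\<dots> = z ^ (j - i)"
        using character_pow[OF H f m(2)] by (simp add: q power_mult z)
      finally show ?thesis using h(4) by (simp add: power_add[symmetric])
    qed
    show ?thesis using that *[of h h' i j] *[of h' h j i] by (cases "i \<le> j") auto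
  qed
  have "bij_betw (\<lambda>g. (restrict g H, g a)) (characters H') R"
    unfolding bij_betw_def
  proof
    have val: "g (h \<otimes> a [^] i) = g h * g a ^ i" if "g \<in> characters H'" "h \<in> H" for g h and i :: nat
    proof -
      have "a [^] i \<in> H'" using H'I[of \<one> i] by simp
      then have "g (h \<otimes> a [^] i) = g h * g (a [^] i)"
        using that sub_H' unfolding characters_def by blast
      then show ?thesis using character_pow[OF \<open>subgroup H' G\<close> that(1) a_H'] by simp
    qed
    show "inj_on (\<lambda>g. (restrict g H, g a)) (characters H')"
    proof (rule inj_onI)
      fix g g' assume g: "g \<in> characters H'" "g' \<in> characters H'"
        and eq: "(restrict g H, g a) = (restrict g' H, g' a)"
      show "g = g'"
      proof (rule extensionalityI)
        show "g \<in> extensional H'" "g' \<in> extensional H'" using g by (auto simp: characters_def)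
        fix x assume "x \<in> H'"
        then obtain h i where x: "h \<in> H" "x = h \<otimes> a [^] (i::nat)" using H'E by metis
        have "g h = g' h" using eq x(1) by (metis prod.inject restrict_apply')
        then show "g x = g' x"
          unfolding x(2) val[OF g(1) x(1)] val[OF g(2) x(1)] using eq by simp
      qed
    qed
    show "(\<lambda>g. (restrict g H, g a)) ` characters H' = R"
    proof
      show "(\<lambda>g. (restrict g H, g a)) ` characters H' \<subseteq> R"
      proof clarify
        fix g assume g: "g \<in> characters H'"
        have "restrict g H \<in> characters H"
          using g sub_H' by (auto simp: characters_def)
        moreover have "g a ^ m = g (a [^] m)"
          using character_pow[OF \<open>subgroup H' G\<close> g a_H'] by simp
        ultimately show "(restrict g H, g a) \<in> R" using m by (simp add: R_def)
      qed
      show "R \<subseteq> (\<lambda>g. (restrict g H, g a)) ` characters H'"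
      proof clarify
        fix f z assume fz: "(f, z) \<in> R"
        then have f: "f \<in> characters H" and z: "z ^ m = f (a [^] m)" by (auto simp: R_def)
        have "\<exists>v. \<forall>h\<in>H. \<forall>i::nat. x = h \<otimes> a [^] i \<longrightarrow> v = f h * z ^ i" if "x \<in> H'" for x
          using H'E[OF that] wd[OF fz] by metis
        then obtain v where v: "\<And>x h i. \<lbrakk>x \<in> H'; h \<in> H; x = h \<otimes> a [^] (i::nat)\<rbrakk> \<Longrightarrow> v x = f h * z ^ i"
          by metis
        define g where "g = restrict v H'"
        have g: "g (h \<otimes> a [^] i) = f h * z ^ i" if "h \<in> H" for h and i :: nat
          using v H'I that by (simp add: g_def)
        have f_H: "g h = f h" if "h \<in> H" for h using g[of h 0] that by simp
        have "f (a [^] m) \<noteq> 0" using f m by (simp add: characters_def)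
        then have "z \<noteq> 0" using z m by (metis power_0_left less_numeral_extra(3))
        have "g \<in> characters H'"
          unfolding characters_def
        proof (intro CollectI conjI ballI)
          show "g \<in> extensional H'" by (simp add: g_def)
          fix x assume "x \<in> H'"
          then obtain h i where x: "h \<in> H" "x = h \<otimes> a [^] (i::nat)" using H'E by metis
          show "g x \<noteq> 0" using x g \<open>z \<noteq> 0\<close> f by (simp add: characters_def)
          fix y assume "y \<in> H'"
          then obtain h' j where y: "h' \<in> H" "y = h' \<otimes> a [^] (j::nat)" using H'E by metis
          have "f (h \<otimes> h') = f h * f h'" using f x y by (simp add: characters_def)
          then show "g (x \<otimes> y) = g x * g y"
            using x y by (simp add: comb g power_add)
        qed
        moreover have "restrict g H = f"
          using f f_H by (intro extensionalityI[of _ H]) (auto simp: characters_def)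
        moreover have "g a = z" using g[of \<one> 1] character_one[OF H f] by simp
        ultimately show "(f, z) \<in> (\<lambda>g. (restrict g H, g a)) ` characters H'" by force
      qed
    qed
  qed
  moreover have "finite R" "card R = m * card H"
  proof -
    \<comment> \<open>A nonzero complex number has exactly \<open>m\<close> roots of order
      \<open>m\<close>, so each \<open>f\<close> contributes \<open>m\<close> pairs.\<close>
    have "finite {z. z ^ m = f (a [^] m)}" "card {z. z ^ m = f (a [^] m)} = m"
      if "f \<in> characters H" for f
      using that m by (auto simp: characters_def card_nth_roots)
    then show "finite R" "card R = m * card H"
      using IH by (auto simp: R_def)
  qed
  ultimately show ?thesis
    by (intro that[of H']) (simp_all add: a_H' sub_H' bij_betw_finite bij_betw_same_card)
qed

text \<open>Among the subgroups with as many characters as elements, the trivial one being an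
  example, take \<open>H\<close> of largest order. Adjoining any element cannot enlarge it, so it is
  the whole group.\<close>

lemma (in comm_group) card_characters:
  assumes fin: "finite (carrier G)"
  shows "card (characters (carrier G)) = card (carrier G)"
proof -
  define P where "P H \<longleftrightarrow> subgroup H G \<and> finite (characters H) \<and> card (characters H) = card H" for H
  have "characters {\<one>} = {\<lambda>x\<in>{\<one>}. 1}"
  proof
    show "characters {\<one>} \<subseteq> {\<lambda>x\<in>{\<one>}. 1}"
    proof
      fix f assume f: "f \<in> characters {\<one>}"
      then have "f = (\<lambda>x\<in>{\<one>}. 1)"
        using character_one[OF triv_subgroup f]
        by (intro extensionalityI[of _ "{\<one>}"]) (auto simp: characters_def)
      then show "f \<in> {\<lambda>x\<in>{\<one>}. 1}" by simp
    qed
  qed (auto simp: characters_def)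
  then have "P {\<one>}" using triv_subgroup by (simp add: P_def)
  moreover have "card H \<le> card (carrier G)" if "P H" for H
    using that fin by (auto simp: P_def intro!: card_mono dest: subgroup.subset)
  ultimately obtain H where H: "P H" and max: "\<And>H'. P H' \<Longrightarrow> card H' \<le> card H"
    using ex_has_greatest_nat[of P "{\<one>}" card "Suc (card (carrier G))"] by (force simp: less_Suc_eq_le)
  have "carrier G \<subseteq> H"
  proof
    fix a assume a: "a \<in> carrier G"
    have sub: "subgroup H G" and char: "finite (characters H)" "card (characters H) = card H"
      using H by (auto simp: P_def)
    obtain H' where H': "P H'" "insert a H \<subseteq> H'"
      by (rule adjoin_element[OF fin sub a char]) (simp add: P_def)
    then have "finite H'" using fin by (metis P_def finite_subset subgroup.subset)
    then have "H' = H"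
      using H' max[of H'] by (metis card_seteq insert_subset)
    then show "a \<in> H" using H' by blast
  qed
  then have "H = carrier G" using H subgroup.subset by (auto simp: P_def)
  then show ?thesis using H by (simp add: P_def)
qed

section \<open>The number of Dirichlet characters\<close>

text \<open>Units are represented by least nonnegative residues. The identity is
  \<open>1 mod int n\<close> so that modulus 1 is covered, where the only residue is 0.\<close>

definition unit_group :: "nat \<Rightarrow> int monoid" where
  "unit_group n = \<lparr>carrier = {a \<in> {0..<int n}. coprime a (int n)},
     mult = (\<lambda>a b. a * b mod int n), one = 1 mod int n\<rparr>"

lemma coprime_mod_left: "coprime (a mod n) n \<longleftrightarrow> coprime a (n::int)"
  by (metis coprime_iff_gcd_eq_1 gcd.commute gcd_red_int)

lemma comm_group_unit_group:
  assumes "n > 0"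
  shows "comm_group (unit_group n)"
proof (rule comm_groupI)
  fix x assume x: "x \<in> carrier (unit_group n)"
  then obtain y where "[x * y = 1] (mod int n)"
    using cong_solve_coprime_int[of x "int n"] by (auto simp: unit_group_def)
  then have y: "y * x mod int n = 1 mod int n" by (simp add: cong_def mult.commute)
  then have "coprime y (int n)"
    by (metis coprime_1_left coprime_mod_left coprime_mult_left_iff)
  with y assms show "\<exists>y\<in>carrier (unit_group n). y \<otimes>\<^bsub>unit_group n\<^esub> x = \<one>\<^bsub>unit_group n\<^esub>"
    by (intro bexI[of _ "y mod int n"]) (auto simp: unit_group_def coprime_mod_left mod_mult_left_eq)
qed (use assms in \<open>auto simp: unit_group_def coprime_mod_left mod_simps mult_ac\<close>)

text \<open>Totatives range from 1 to \<open>n\<close>, the carrier from 0 to \<open>n - 1\<close>.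
  The differing endpoints are coprime to \<open>n\<close> only for \<open>n = 1\<close>, which is
  therefore treated apart.\<close>

lemma card_unit_group:
  assumes "n > 0"
  shows "card (carrier (unit_group n)) = totient n"
proof (cases "n = 1")
  case True
  then have "carrier (unit_group n) = {0}" by (auto simp: unit_group_def)
  then show ?thesis using True by simp
next
  case False
  have "bij_betw int (totatives n) (carrier (unit_group n))"
  proof (rule bij_betwI[of _ _ _ nat])
    show "int \<in> totatives n \<rightarrow> carrier (unit_group n)"
      using False assms totatives_less by (auto simp: unit_group_def in_totatives_iff)
    show "nat \<in> carrier (unit_group n) \<rightarrow> totatives n"
    proof
      fix a assume "a \<in> carrier (unit_group n)"
      then obtain k where "a = int k" "k < n" "coprime k n"
        by (auto simp: unit_group_def elim!: nonneg_int_cases)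
      then show "nat a \<in> totatives n"
        using False by (cases "k = 0") (auto simp: in_totatives_iff)
    qed
  qed (auto simp: unit_group_def)
  then show ?thesis by (metis bij_betw_same_card totient_def)
qed

section \<open>Dirichlet characters as characters of the unit group\<close>

lemma periodic_mod:
  fixes f :: "int \<Rightarrow> 'b"
  assumes "\<And>a. f (a + int n) = f a"
  shows "f (a mod int n) = f a"
proof -
  have *: "f (b + int k * int n) = f b" for b k
  proof (induction k)
    case (Suc k)
    then show ?case using assms[of "b + int k * int n"] by (simp add: algebra_simps)
  qed simp
  \<comment> \<open>For negative \<open>q\<close> the nonnegative case is applied from the starting
    point \<open>b + q * int n\<close>.\<close>
  have "f (b + q * int n) = f b" for b q
    using *[of b "nat q"] *[of "b + q * int n" "nat (- q)"] by (cases "q \<ge> 0") auto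
  from this[of "a mod int n" "a div int n"] show ?thesis by simp
qed

lemma dirichlet_character_mult:
  "\<chi> \<in> dirichlet_characters n \<Longrightarrow> \<chi> (a * b) = \<chi> a * \<chi> b"
  and dirichlet_character_eq_0_iff:
  "\<chi> \<in> dirichlet_characters n \<Longrightarrow> \<chi> a = 0 \<longleftrightarrow> \<not> coprime a (int n)"
  and dirichlet_character_mod:
  "\<chi> \<in> dirichlet_characters n \<Longrightarrow> \<chi> (a mod int n) = \<chi> a"
  by (auto simp: dirichlet_characters_def dirichlet_character_def intro!: periodic_mod)

lemma dirichlet_character_1:
  assumes "\<chi> \<in> dirichlet_characters n"
  shows "\<chi> 1 = 1"
  using dirichlet_character_mult[OF assms, of 1 1] dirichlet_character_eq_0_iff[OF assms, of 1] by auto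

lemma dirichlet_character_cong:
  assumes "\<chi> \<in> dirichlet_characters n" "[a = b] (mod int n)"
  shows "\<chi> a = \<chi> b"
  using dirichlet_character_mod[OF assms(1)] assms(2) by (metis cong_def)

text \<open>Restriction to the residues in the unit group is a bijection onto the characters of that
  group; its inverse \<open>?ext\<close> reduces the argument modulo \<open>n\<close> and extends by
  zero.\<close>

lemma card_dirichlet_characters:
  assumes "n > 0"
  shows "card (dirichlet_characters n) = totient n"
proof -
  interpret comm_group "unit_group n" by (rule comm_group_unit_group[OF assms])
  let ?U = "carrier (unit_group n)"
  let ?ext = "\<lambda>f a. if coprime a (int n) then f (a mod int n) else (0::complex)"
  have U: "a mod int n \<in> ?U \<longleftrightarrow> coprime a (int n)" for a
    using assms by (auto simp: unit_group_def coprime_mod_left)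
  have U_mod: "a mod int n = a" if "a \<in> ?U" for a
    using that by (auto simp: unit_group_def)
  have U_cop: "coprime a (int n)" if "a \<in> ?U" for a
    using that by (auto simp: unit_group_def)
  have "bij_betw (\<lambda>\<chi>. restrict \<chi> ?U) (dirichlet_characters n) (characters ?U)"
  proof (rule bij_betwI[of _ _ _ ?ext])
    show "(\<lambda>\<chi>. restrict \<chi> ?U) \<in> dirichlet_characters n \<rightarrow> characters ?U"
    proof
      fix \<chi> assume \<chi>: "\<chi> \<in> dirichlet_characters n"
      have "x \<otimes>\<^bsub>unit_group n\<^esub> y = x * y mod int n" for x y by (simp add: unit_group_def)
      then show "restrict \<chi> ?U \<in> characters ?U"
        using m_closed by (auto simp: characters_def U_cop dirichlet_character_eq_0_iff[OF \<chi>]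
          dirichlet_character_mod[OF \<chi>] dirichlet_character_mult[OF \<chi>])
    qed
    show "?ext \<in> characters ?U \<rightarrow> dirichlet_characters n"
    proof
      fix f assume f: "f \<in> characters ?U"
      have "f (a * b mod int n) = f (a mod int n) * f (b mod int n)"
        if "coprime a (int n)" "coprime b (int n)" for a b
      proof -
        have "f ((a mod int n) \<otimes>\<^bsub>unit_group n\<^esub> (b mod int n)) = f (a mod int n) * f (b mod int n)"
          using f U[THEN iffD2, OF that(1)] U[THEN iffD2, OF that(2)] by (simp add: characters_def)
        then show ?thesis by (simp add: unit_group_def mod_simps)
      qed
      moreover have "f (a mod int n) \<noteq> 0" if "coprime a (int n)" for a
        using f that U unfolding characters_def by blast
      moreover have "coprime (a + int n) (int n) \<longleftrightarrow> coprime a (int n)" for a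
        by (metis coprime_mod_left mod_add_self2)
      ultimately show "?ext f \<in> dirichlet_characters n"
        by (auto simp: dirichlet_characters_def dirichlet_character_def)
    qed
    show "?ext (restrict \<chi> ?U) = \<chi>" if \<chi>: "\<chi> \<in> dirichlet_characters n" for \<chi>
      using U by (auto simp: fun_eq_iff dirichlet_character_mod[OF \<chi>] dirichlet_character_eq_0_iff[OF \<chi>])
    show "restrict (?ext f) ?U = f" if "f \<in> characters ?U" for f
      using that by (intro extensionalityI[of _ ?U]) (auto simp: characters_def U_mod U_cop)
  qed
  moreover have "finite ?U" by (rule finite_subset[of _ "{0..<int n}"]) (auto simp: unit_group_def)
  ultimately show ?thesis
    using card_characters card_unit_group[OF assms] by (simp add: bij_betw_same_card)
qed

section \<open>The proportion of primitive characters\<close>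

lemma finite_dirichlet_characters: "n > 0 \<Longrightarrow> finite (dirichlet_characters n)"
  using card_dirichlet_characters[of n] by (intro card_ge_0_finite) simp

section \<open>Characters induced from a divisor\<close>

text \<open>For \<open>d\<close> dividing \<open>n\<close> the integers \<open>a\<close> considered
  represent the kernel \<open>K d\<close> of reduction from the units modulo \<open>n\<close> to
  those modulo \<open>d\<close>.\<close>

definition trivial_on_kernel :: "nat \<Rightarrow> nat \<Rightarrow> (int \<Rightarrow> complex) set" where
  "trivial_on_kernel n d = {\<chi> \<in> dirichlet_characters n.
     \<forall>a. coprime a (int n) \<longrightarrow> [a = 1] (mod int d) \<longrightarrow> \<chi> a = 1}"

text \<open>For \<open>d\<close> dividing \<open>n\<close> this is surjectivity of reduction on
  units. With \<open>t\<close> the product of the primes of \<open>n\<close> not dividing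
  \<open>a\<close>, the lift is \<open>a + int d * t\<close>: each prime of \<open>n\<close> divides
  exactly one of \<open>a\<close> and \<open>int d * t\<close>, or only the latter through
  \<open>t\<close>, and hence not their sum.\<close>

lemma ex_coprime_lift:
  fixes a :: int
  assumes "n > 0" "coprime a (int d)"
  shows "\<exists>b. [b = a] (mod int d) \<and> coprime b (int n)"
proof -
  define t where "t = (\<Prod>p\<in>{p\<in>prime_factors n. \<not> int p dvd a}. int p)"
  have "coprime (a + int d * t) (int n)"
  proof (rule ccontr)
    assume "\<not> coprime (a + int d * t) (int n)"
    then obtain p where p: "prime p" "p dvd a + int d * t" "p dvd int n"
      using prime_divisor_exists[of "gcd (a + int d * t) (int n)"] assms(1)
      by (auto simp: coprime_iff_gcd_eq_1)
    obtain q where q: "p = int q" using p(1) by (metis nonneg_int_cases prime_ge_0_int)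
    have qP: "q \<in> prime_factors n" using p q assms(1) by (simp add: prime_factors_dvd)
    show False
    proof (cases "p dvd a")
      case True
      then have "p dvd int d \<or> p dvd t"
        using p by (metis dvd_add_right_iff prime_dvd_mult_iff)
      moreover have "\<not> p dvd int d"
        using True assms(2) p(1) by (meson coprime_common_divisor not_prime_unit)
      ultimately have "p dvd t" by blast
      then obtain r where r: "r \<in> prime_factors n" "\<not> int r dvd a" "p dvd int r"
        unfolding t_def using p(1) by (auto simp: prime_dvd_prod_iff)
      then have "q = r" using q p(1) by (auto simp: in_prime_factors_iff primes_dvd_imp_eq)
      then show False using r True q by simp
    next
      case False
      then have "p dvd t" unfolding t_def q using qP q by (intro dvd_prodI) auto
      then show False using False p(2) by (metis dvd_add_left_iff dvd_mult)
    qed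
  qed
  moreover have "[a + int d * t = a] (mod int d)" by (simp add: cong_def)
  ultimately show ?thesis by blast
qed

text \<open>Multiplying by an inverse \<open>c\<close> of \<open>b\<close> modulo \<open>n\<close>
  turns \<open>a\<close> into a unit that is 1 modulo \<open>d\<close>, where the character is
  1.\<close>

lemma trivial_on_kernel_eq:
  assumes "\<chi> \<in> trivial_on_kernel n d" "d dvd n"
    and "coprime a (int n)" "coprime b (int n)" "[a = b] (mod int d)"
  shows "\<chi> a = \<chi> b"
proof -
  have \<chi>: "\<chi> \<in> dirichlet_characters n" using assms(1) by (simp add: trivial_on_kernel_def)
  obtain c where c: "[b * c = 1] (mod int n)" using cong_solve_coprime_int assms(4) by blast
  then have "coprime (b * c) (int n)" by (metis coprime_1_left cong_imp_coprime cong_sym)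
  then have "coprime (a * c) (int n)" using assms(3) by simp
  moreover have "[a * c = 1] (mod int d)"
    using c assms(2,5) by (metis cong_dvd_modulus cong_scalar_right cong_trans of_nat_dvd_iff)
  ultimately have "\<chi> (a * c) = 1" using assms(1) by (simp add: trivial_on_kernel_def)
  moreover have "\<chi> (b * c) = 1" using dirichlet_character_cong[OF \<chi> c] dirichlet_character_1[OF \<chi>] by simp
  ultimately show ?thesis
    unfolding dirichlet_character_mult[OF \<chi>] by (metis mult_cancel_right mult_zero_right zero_neq_one)
qed

lemma induced_imp_trivial_on_kernel:
  assumes "\<chi> \<in> dirichlet_characters n" "\<psi> \<in> dirichlet_characters d" "induced_by n \<chi> \<psi>"
  shows "\<chi> \<in> trivial_on_kernel n d"
proof -
  have "\<chi> a = 1" if "coprime a (int n)" "[a = 1] (mod int d)" for a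
    using that assms dirichlet_character_cong[OF assms(2) that(2)] dirichlet_character_1[OF assms(2)]
    by (simp add: induced_by_def)
  then show ?thesis using assms(1) by (simp add: trivial_on_kernel_def)
qed

text \<open>The inducing character takes at \<open>a\<close> the value of \<chi> at a lift of
  \<open>a\<close> to a unit modulo \<open>n\<close>. Independence of the lift gives periodicity and
  multiplicativity.\<close>

lemma trivial_on_kernel_imp_induced:
  assumes n: "n > 0" and d: "d dvd n" and \<chi>: "\<chi> \<in> trivial_on_kernel n d"
  shows "\<exists>\<psi>\<in>dirichlet_characters d. induced_by n \<chi> \<psi>"
proof -
  have X: "\<chi> \<in> dirichlet_characters n" using \<chi> by (simp add: trivial_on_kernel_def)
  obtain l where l: "\<And>a. coprime a (int d) \<Longrightarrow> [l a = a] (mod int d) \<and> coprime (l a) (int n)"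
    using ex_coprime_lift[OF n, of _ d] by metis
  define \<psi> where "\<psi> a = (if coprime a (int d) then \<chi> (l a) else 0)" for a
  have cop: "coprime a (int d)" if "coprime a (int n)" for a
    using that d by (meson coprime_divisors dvd_refl of_nat_dvd_iff)
  have \<psi>: "\<psi> a = \<chi> b" if "coprime b (int n)" "[b = a] (mod int d)" for a b
  proof -
    have "coprime a (int d)" using that cop cong_imp_coprime by blast
    then show ?thesis
      using trivial_on_kernel_eq[OF \<chi> d] l that unfolding \<psi>_def by (metis cong_sym cong_trans)
  qed
  have add: "coprime (a + int d) (int d) \<longleftrightarrow> coprime a (int d)" for a
    by (metis coprime_mod_left mod_add_self2)
  have "\<psi> (a + int d) = \<psi> a" for a
  proof (cases "coprime a (int d)")
    case True
    then show ?thesis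
      using \<psi>[of "l a" a] \<psi>[of "l a" "a + int d"] l[OF True] by (simp add: cong_def)
  qed (simp add: \<psi>_def add)
  moreover have "\<psi> (a * b) = \<psi> a * \<psi> b" for a b
  proof (cases "coprime a (int d) \<and> coprime b (int d)")
    case True
    then have "\<psi> (a * b) = \<chi> (l a * l b)" using l by (intro \<psi>) (auto intro: cong_mult)
    then show ?thesis using True by (simp add: dirichlet_character_mult[OF X] \<psi>_def)
  qed (auto simp: \<psi>_def)
  moreover have "\<psi> a = 0 \<longleftrightarrow> \<not> coprime a (int d)" for a
    using l by (auto simp: \<psi>_def dirichlet_character_eq_0_iff[OF X])
  ultimately have "\<psi> \<in> dirichlet_characters d"
    by (simp add: dirichlet_characters_def dirichlet_character_def)
  moreover have "induced_by n \<chi> \<psi>"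
    using \<psi> by (simp add: induced_by_def)
  ultimately show ?thesis by blast
qed

text \<open>Setting a character modulo \<open>d\<close> to zero off the units modulo
  \<open>n\<close> is a bijection onto this set. It is injective because every unit modulo
  \<open>d\<close> lifts to a unit modulo \<open>n\<close>.\<close>

lemma card_trivial_on_kernel:
  assumes n: "n > 0" and d: "d dvd n"
  shows "card (trivial_on_kernel n d) = totient d"
proof -
  let ?ind = "\<lambda>\<psi> a. if coprime a (int n) then \<psi> a else (0::complex)"
  have cop: "coprime a (int d)" if "coprime a (int n)" for a
    using that d by (meson coprime_divisors dvd_refl of_nat_dvd_iff)
  have "inj_on ?ind (dirichlet_characters d)"
  proof (rule inj_onI)
    fix \<psi> \<phi> assume \<psi>: "\<psi> \<in> dirichlet_characters d" and \<phi>: "\<phi> \<in> dirichlet_characters d"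
      and eq: "?ind \<psi> = ?ind \<phi>"
    show "\<psi> = \<phi>"
    proof
      fix a
      show "\<psi> a = \<phi> a"
      proof (cases "coprime a (int d)")
        case True
        then obtain b where b: "[b = a] (mod int d)" "coprime b (int n)"
          using ex_coprime_lift[OF n] by blast
        then have "\<psi> b = \<phi> b" using fun_cong[OF eq, of b] by simp
        then show ?thesis
          using dirichlet_character_cong[OF \<psi> b(1)] dirichlet_character_cong[OF \<phi> b(1)] by simp
      next
        case False
        then show ?thesis
          using dirichlet_character_eq_0_iff[OF \<psi>] dirichlet_character_eq_0_iff[OF \<phi>] by metis
      qed
    qed
  qed
  moreover have "?ind ` dirichlet_characters d = trivial_on_kernel n d"
  proof
    show "?ind ` dirichlet_characters d \<subseteq> trivial_on_kernel n d"
    proof (rule image_subsetI)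
      fix \<psi> assume \<psi>: "\<psi> \<in> dirichlet_characters d"
      have "\<psi> (a + int n) = \<psi> a" for a
        using d by (intro dirichlet_character_cong[OF \<psi>]) (auto simp: cong_iff_dvd_diff)
      moreover have "coprime (a + int n) (int n) \<longleftrightarrow> coprime a (int n)" for a
        by (metis coprime_mod_left mod_add_self2)
      ultimately have "?ind \<psi> \<in> dirichlet_characters n"
        using cop by (auto simp: dirichlet_characters_def dirichlet_character_def
          dirichlet_character_mult[OF \<psi>] dirichlet_character_eq_0_iff[OF \<psi>])
      moreover have "induced_by n (?ind \<psi>) \<psi>" by (simp add: induced_by_def)
      ultimately show "?ind \<psi> \<in> trivial_on_kernel n d"
        using induced_imp_trivial_on_kernel \<psi> by blast
    qed
    show "trivial_on_kernel n d \<subseteq> ?ind ` dirichlet_characters d"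
    proof
      fix \<chi> assume \<chi>: "\<chi> \<in> trivial_on_kernel n d"
      then have X: "\<chi> \<in> dirichlet_characters n" by (simp add: trivial_on_kernel_def)
      obtain \<psi> where \<psi>: "\<psi> \<in> dirichlet_characters d" "induced_by n \<chi> \<psi>"
        using trivial_on_kernel_imp_induced[OF n d \<chi>] by blast
      then have "\<chi> = ?ind \<psi>"
        by (auto simp: fun_eq_iff induced_by_def dirichlet_character_eq_0_iff[OF X])
      then show "\<chi> \<in> ?ind ` dirichlet_characters d" using \<psi>(1) by blast
    qed
  qed
  ultimately have "card (trivial_on_kernel n d) = card (dirichlet_characters d)"
    using card_image by metis
  moreover have "d > 0" using n d by (auto intro: Nat.gr0I)
  ultimately show ?thesis by (simp add: card_dirichlet_characters)
qed

lemma trivial_on_kernel_mono: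
  assumes "d dvd e"
  shows "trivial_on_kernel n d \<subseteq> trivial_on_kernel n e"
proof -
  have "[a = 1] (mod int d)" if "[a = 1] (mod int e)" for a
    using that assms by (meson cong_dvd_modulus of_nat_dvd_iff)
  then show ?thesis by (auto simp: trivial_on_kernel_def)
qed

text \<open>With \<open>n = lcm d e\<close>, every unit that is 1 modulo \<open>gcd d e\<close> is modulo \<open>n\<close> a product of a
  unit that is 1 modulo \<open>d\<close> and a unit that is 1 modulo \<open>e\<close>.\<close>
lemma trivial_on_kernel_Int:
  assumes "lcm d e = n"
  shows "trivial_on_kernel n d \<inter> trivial_on_kernel n e = trivial_on_kernel n (gcd d e)"
proof
  show "trivial_on_kernel n (gcd d e) \<subseteq> trivial_on_kernel n d \<inter> trivial_on_kernel n e"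
    by (simp add: trivial_on_kernel_mono)
  show "trivial_on_kernel n d \<inter> trivial_on_kernel n e \<subseteq> trivial_on_kernel n (gcd d e)"
  proof
    fix \<chi> assume \<chi>: "\<chi> \<in> trivial_on_kernel n d \<inter> trivial_on_kernel n e"
    have dn: "d dvd n" and en: "e dvd n" using assms by auto
    have "\<chi> a = 1" if a: "coprime a (int n)" "[a = 1] (mod int (gcd d e))" for a
    proof -
      obtain u v where "u * int d + v * int e = gcd (int d) (int e)" using bezout_int by blast
      moreover obtain k where "a - 1 = gcd (int d) (int e) * k"
        using a(2) by (auto simp: cong_iff_dvd_diff dvd_def)
      ultimately have ak: "a - 1 = (u * int d + v * int e) * k" by simp
      \<comment> \<open>By Bezout, \<open>b\<close> is 1 modulo \<open>d\<close> and
        \<open>a\<close> modulo \<open>e\<close>. Triviality for \<open>d\<close> gives the value 1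
        at \<open>b\<close>, and triviality for \<open>e\<close> carries it over to
        \<open>a\<close>.\<close>
      define b where "b = 1 + u * k * int d"
      have "b = a - v * k * int e"
        using ak by (simp add: b_def algebra_simps)
      then have be: "[b = a] (mod int e)" by (simp add: cong_iff_dvd_diff)
      have bd: "[b = 1] (mod int d)" by (simp add: b_def cong_iff_dvd_diff)
      have "coprime b (int e)"
        using be a(1) en by (meson cong_imp_coprime cong_sym coprime_divisors dvd_refl of_nat_dvd_iff)
      moreover have "coprime b (int d)"
        using bd by (meson cong_imp_coprime cong_sym coprime_1_left)
      ultimately have "coprime b (int d * int e)" by simp
      moreover have "int n dvd int d * int e" using assms by (metis lcm_least dvd_triv_left dvd_triv_right of_nat_dvd_iff of_nat_mult)
      ultimately have b: "coprime b (int n)" by (meson coprime_divisors dvd_refl)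
      then have "\<chi> b = 1" using \<chi> bd by (auto simp: trivial_on_kernel_def)
      moreover have "\<chi> b = \<chi> a" using \<chi> by (intro trivial_on_kernel_eq[OF _ en b a(1) be]) auto
      ultimately show ?thesis by simp
    qed
    then show "\<chi> \<in> trivial_on_kernel n (gcd d e)" using \<chi> by (auto simp: trivial_on_kernel_def)
  qed
qed

lemma trivial_on_kernel_self: "trivial_on_kernel n n = dirichlet_characters n"
proof -
  have "\<chi> \<in> trivial_on_kernel n n" if "\<chi> \<in> dirichlet_characters n" for \<chi>
    using that by (intro induced_imp_trivial_on_kernel[of \<chi> n \<chi>]) (auto simp: induced_by_def)
  then show ?thesis by (auto simp: trivial_on_kernel_def)
qed

section \<open>Primitivity and the product formula\<close>

text \<open>The conductor is the least divisor \<open>d\<close> with \<chi> in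
  \<open>trivial_on_kernel n d\<close>. If it is a proper divisor of \<open>n\<close>, it divides
  \<open>n div p\<close> for some prime \<open>p\<close>, and these sets grow along
  divisibility.\<close>

lemma primitive_characters_eq:
  assumes n: "n > 0"
  shows "primitive_characters n =
    {\<chi> \<in> dirichlet_characters n. \<forall>p\<in>prime_factors n. \<chi> \<notin> trivial_on_kernel n (n div p)}"
proof -
  have "conductor n \<chi> = n \<longleftrightarrow> (\<forall>p\<in>prime_factors n. \<chi> \<notin> trivial_on_kernel n (n div p))"
    if \<chi>: "\<chi> \<in> dirichlet_characters n" for \<chi>
  proof -
    define Q where "Q d \<longleftrightarrow> d dvd n \<and> (\<exists>\<psi>\<in>dirichlet_characters d. induced_by n \<chi> \<psi>)" for d
    have Q: "Q d \<longleftrightarrow> d dvd n \<and> \<chi> \<in> trivial_on_kernel n d" for d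
      unfolding Q_def using \<chi> n induced_imp_trivial_on_kernel trivial_on_kernel_imp_induced by blast
    have cond: "conductor n \<chi> = (LEAST d. Q d)" by (simp add: conductor_def Q_def)
    have "Q n" using \<chi> by (simp add: Q trivial_on_kernel_self)
    then have Q_cond: "Q (conductor n \<chi>)" and le: "\<And>d. Q d \<Longrightarrow> conductor n \<chi> \<le> d"
      unfolding cond by (auto intro: LeastI Least_le)
    show ?thesis
    proof
      assume eq: "conductor n \<chi> = n"
      show "\<forall>p\<in>prime_factors n. \<chi> \<notin> trivial_on_kernel n (n div p)"
      proof (intro ballI notI)
        fix p assume p: "p \<in> prime_factors n" and "\<chi> \<in> trivial_on_kernel n (n div p)"
        then have "Q (n div p)" by (auto simp: Q in_prime_factors_iff intro: div_dvd_iff_mult[THEN iffD2])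
        then have "n \<le> n div p" using le eq by metis
        moreover have "p > 1" using p prime_gt_1_nat by auto
        ultimately show False using n by (meson int_div_less_self div_less_dividend leD)
      qed
    next
      assume *: "\<forall>p\<in>prime_factors n. \<chi> \<notin> trivial_on_kernel n (n div p)"
      show "conductor n \<chi> = n"
      proof (rule ccontr)
        assume ne: "conductor n \<chi> \<noteq> n"
        obtain k where k: "n = conductor n \<chi> * k" using Q_cond Q by (auto simp: dvd_def)
        with ne have "k \<noteq> 1" by auto
        then obtain p where p: "prime p" "p dvd k" using prime_factor_nat by blast
        then obtain j where j: "k = p * j" by (auto simp: dvd_def)
        have "n div p = conductor n \<chi> * j" using k j p(1) by (metis nonzero_mult_div_cancel_left mult.left_commute not_prime_0)
        then have "\<chi> \<in> trivial_on_kernel n (n div p)"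
          using Q_cond Q trivial_on_kernel_mono by (metis dvd_triv_left subsetD)
        moreover have "p \<in> prime_factors n" using p k n by (metis dvd_mult in_prime_factors_iff less_irrefl)
        ultimately show False using * by blast
      qed
    qed
  qed
  then show ?thesis by (auto simp: primitive_characters_def)
qed

text \<open>This is one minus the reciprocal of the order of \<open>K (n div p)\<close>. It vanishes
  at 2 when 2 divides \<open>n\<close> exactly once, matching the absence of primitive characters
  for such \<open>n\<close>.\<close>

definition local_density :: "nat \<Rightarrow> nat \<Rightarrow> real" where
  "local_density n p = (if p\<^sup>2 dvd n then 1 - 1 / real p else 1 - 1 / (real p - 1))"

lemma totient_div_prime:
  assumes "m > 0" "prime p" "p dvd m"
  shows "real (totient (m div p)) = real (totient m) * (1 - local_density m p)"
proof -
  obtain k where k: "m = p * k" using assms(3) by (auto simp: dvd_def)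
  have p: "p > 1" using assms(2) by (rule prime_gt_1_nat)
  have sq: "p\<^sup>2 dvd m \<longleftrightarrow> p dvd k" using p by (simp add: k power2_eq_square)
  have "totient m = (if p dvd k then p else p - 1) * totient k"
  proof (cases "p dvd k")
    case True
    then have "totient m * totient p = totient p * totient k * p"
      using totient_gcd[of p k] by (simp add: k gcd_nat.absorb1)
    then show ?thesis using True p by simp
  next
    case False
    then have "coprime p k" using assms(2) by (simp add: prime_imp_coprime)
    then show ?thesis using False assms(2) by (simp add: k totient_mult_coprime totient_prime)
  qed
  then show ?thesis
    using p sq by (auto simp: local_density_def of_nat_diff k)
qed

text \<open>The auxiliary divisor \<open>s\<close> carries the induction. Requiring nontriviality
  for a further prime \<open>p\<close> removes the characters counted for \<open>s * p\<close>, so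
  the totient of \<open>n div s\<close> is diminished by that of \<open>n div (s * p)\<close>, which
  amounts to the factor \<open>local_density n p\<close>.\<close>

lemma card_nontrivial_on_kernels:
  assumes n: "n > 0" and "finite T" "s dvd n" and "\<And>p. p \<in> T \<Longrightarrow> prime p \<and> p dvd n \<and> \<not> p dvd s"
  shows "real (card {\<chi> \<in> trivial_on_kernel n (n div s). \<forall>p\<in>T. \<chi> \<notin> trivial_on_kernel n (n div p)})
    = real (totient (n div s)) * (\<Prod>p\<in>T. local_density n p)"
  using assms(2-)
proof (induction T arbitrary: s rule: finite_induct)
  case empty
  then have "n div s dvd n" by (metis dvd_def dvd_div_mult_self mult.commute)
  then show ?case by (simp add: card_trivial_on_kernel[OF n])
next
  case (insert p T)
  let ?N = "\<lambda>s. {\<chi> \<in> trivial_on_kernel n (n div s). \<forall>p\<in>T. \<chi> \<notin> trivial_on_kernel n (n div p)}"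
  have p: "prime p" "p dvd n" "\<not> p dvd s" using insert.prems(2) by auto
  have cop: "coprime p s" using p by (simp add: prime_imp_coprime)
  then have sp: "s * p dvd n" using p insert.prems(1) by (simp add: divides_mult mult.commute)
  then obtain m where m: "n = s * p * m" by (auto simp: dvd_def)
  have pos: "s > 0" "p > 0" "m > 0" using m n by (auto intro: Nat.gr0I)
  have div: "n div s = p * m" "n div p = s * m" "n div (s * p) = m"
    using m pos by (simp_all add: mult_ac)
  \<comment> \<open>The greatest common divisor of \<open>n div s\<close> and \<open>n div p\<close>
    is \<open>n div (s * p)\<close>, and their least common multiple is \<open>n\<close>, as
    \<open>trivial_on_kernel_Int\<close> requires.\<close>
  have gcd: "gcd (p * m) (s * m) = m"
    using cop by (simp add: gcd_mult_distrib_nat[symmetric] mult.commute[of _ m])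
  then have "lcm (p * m) (s * m) = n"
    using m pos by (simp add: lcm_nat_def mult_ac)
  note gcd = gcd this
  then have Int: "trivial_on_kernel n (n div s) \<inter> trivial_on_kernel n (n div p) = trivial_on_kernel n (n div (s * p))"
    using gcd trivial_on_kernel_Int[of "p * m" "s * m" n] by (simp add: div)
  have sub: "?N (s * p) \<subseteq> ?N s" using Int by blast
  have "trivial_on_kernel n (n div s) \<subseteq> dirichlet_characters n" by (auto simp: trivial_on_kernel_def)
  then have fin: "finite (?N s)"
    using finite_dirichlet_characters[OF n] by (auto intro: finite_subset)
  have "{\<chi> \<in> trivial_on_kernel n (n div s). \<forall>q\<in>insert p T. \<chi> \<notin> trivial_on_kernel n (n div q)} = ?N s - ?N (s * p)"
    using Int by blast
  then have "real (card {\<chi> \<in> trivial_on_kernel n (n div s). \<forall>q\<in>insert p T. \<chi> \<notin> trivial_on_kernel n (n div q)})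
     = real (card (?N s)) - real (card (?N (s * p)))"
    using fin sub by (simp add: card_Diff_subset finite_subset card_mono of_nat_diff)
  also have "real (card (?N s)) = real (totient (n div s)) * (\<Prod>p\<in>T. local_density n p)"
    using insert.prems by (intro insert.IH) auto
  also have "real (card (?N (s * p))) = real (totient (n div (s * p))) * (\<Prod>p\<in>T. local_density n p)"
  proof (intro insert.IH)
    show "prime q \<and> q dvd n \<and> \<not> q dvd s * p" if "q \<in> T" for q
      using insert.prems(2)[of q] that insert.hyps(2) p(1) primes_dvd_imp_eq[of q p]
      by (auto simp: prime_dvd_mult_iff)
  qed (rule sp)
  \<comment> \<open>Since \<open>p\<close> does not divide \<open>s\<close>, the local density at
    \<open>p\<close> is the same for \<open>n div s\<close> as for \<open>n\<close>.\<close>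
  also have "p\<^sup>2 dvd p * m \<longleftrightarrow> p\<^sup>2 dvd n"
  proof -
    have "coprime (p\<^sup>2) s" using cop by simp
    moreover have "n = s * (p * m)" using m by simp
    ultimately show ?thesis by (simp add: coprime_dvd_mult_right_iff)
  qed
  then have "real (totient (n div (s * p))) = real (totient (n div s)) * (1 - local_density n p)"
    using totient_div_prime[of "p * m" p] pos p(1) by (simp add: div local_density_def)
  finally show ?case using insert.hyps by (simp add: algebra_simps)
qed

theorem primitive_proportion_eq:
  assumes n: "n > 0"
  shows "primitive_proportion n = (\<Prod>p\<in>prime_factors n. local_density n p)"
proof -
  have "real (card (primitive_characters n)) = real (totient n) * (\<Prod>p\<in>prime_factors n. local_density n p)"
  proof -
    have "prime p \<and> p dvd n \<and> \<not> p dvd 1" if "p \<in> prime_factors n" for p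
      using that by (auto simp: in_prime_factors_iff)
    then show ?thesis
      using card_nontrivial_on_kernels[OF n, of "prime_factors n" 1]
      by (simp add: primitive_characters_eq[OF n] trivial_on_kernel_self)
  qed
  then show ?thesis using n by (simp add: primitive_proportion_def card_dirichlet_characters)
qed

section \<open>Comparison with primorials\<close>

text \<open>If all of \<open>P\<close> lay below the element with index \<open>k\<close>, it would
  be contained in the \<open>k\<close> elements before that one, too few for
  \<open>Suc k\<close>.\<close>

lemma enumerate_le_Max:
  fixes A P :: "nat set"
  assumes "infinite A" "finite P" "P \<subseteq> A" "card P = Suc k"
  shows "enumerate A k \<le> Max P"
proof (rule ccontr)
  assume less: "\<not> enumerate A k \<le> Max P"
  have "P \<subseteq> enumerate A ` {..<k}"
  proof
    fix x assume x: "x \<in> P"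
    then obtain i where i: "enumerate A i = x" using enumerate_Ex assms(1,3) by blast
    have "x < enumerate A k" using less x Max_ge[OF assms(2) x] by linarith
    then show "x \<in> enumerate A ` {..<k}" using i assms(1) by auto
  qed
  then have "card P \<le> card {..<k}" using surj_card_le by blast
  then show False using assms(4) by simp
qed

text \<open>Induction on \<open>k\<close>, splitting off the largest element of \<open>P\<close>,
  which is at least the last element enumerated.\<close>

lemma prod_enumerate_le:
  fixes f :: "nat \<Rightarrow> 'a::linordered_semidom"
  assumes A: "infinite A" and f: "\<And>x. x \<in> A \<Longrightarrow> 0 \<le> f x" "\<And>x y. x \<in> A \<Longrightarrow> y \<in> A \<Longrightarrow> x \<le> y \<Longrightarrow> f x \<le> f y"
    and P: "finite P" "P \<subseteq> A" "card P = k"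
  shows "(\<Prod>i<k. f (enumerate A i)) \<le> (\<Prod>p\<in>P. f p)"
  using P
proof (induction k arbitrary: P)
  case (Suc k)
  then have "P \<noteq> {}" by auto
  then have Max: "Max P \<in> P" using Suc.prems by simp
  have "(\<Prod>i<k. f (enumerate A i)) * f (enumerate A k) \<le> (\<Prod>p\<in>P - {Max P}. f p) * f (Max P)"
  proof (rule mult_mono)
    show "(\<Prod>i<k. f (enumerate A i)) \<le> (\<Prod>p\<in>P - {Max P}. f p)"
      using Suc.prems Max by (intro Suc.IH) auto
    show "f (enumerate A k) \<le> f (Max P)"
      using Suc.prems Max enumerate_le_Max[OF A] A by (intro f) (auto simp: enumerate_in_set)
    show "0 \<le> f (enumerate A k)" using A by (simp add: f enumerate_in_set)
    show "0 \<le> (\<Prod>p\<in>P - {Max P}. f p)" using Suc.prems by (intro prod_nonneg f) auto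
  qed
  also have "\<dots> = (\<Prod>p\<in>P. f p)" using Suc.prems Max by (simp add: prod.remove mult.commute)
  finally show ?case by simp
qed simp

section \<open>Small primes and the size of primorials\<close>

abbreviation "nth_prime \<equiv> enumerate {p::nat. prime p}"

lemma infinite_primes: "infinite {p::nat. prime p}"
  using primes_infinite by simp

lemma prime_nth_prime: "prime (nth_prime i)"
  using enumerate_in_set[OF infinite_primes] by simp

lemma nth_prime_0: "nth_prime 0 = 2"
  unfolding enumerate_0 by (rule Least_equality) (auto intro: prime_ge_2_nat)

lemma nth_prime_1: "nth_prime (Suc 0) = 3"
proof -
  have "nth_prime (Suc 0) = (LEAST p. prime p \<and> 2 < p)"
    using enumerate_Suc''[OF infinite_primes, of 0] by (simp add: nth_prime_0)
  also have "\<dots> = 3" by (rule Least_equality) auto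
  finally show ?thesis .
qed

text \<open>Indices start at 0, so this concerns the third prime onwards. It supplies the factor 5
  for odd \<open>n\<close> in \<open>two_primorial_le\<close>.\<close>

lemma nth_prime_ge_5:
  assumes "i \<ge> 2"
  shows "nth_prime i \<ge> 5"
proof -
  have "nth_prime (Suc 0) < nth_prime i" using assms infinite_primes by simp
  then have "nth_prime i > 3" by (simp add: nth_prime_1)
  moreover have "nth_prime i \<noteq> 4"
  proof
    assume "nth_prime i = 4"
    then have "prime (2 * 2 :: nat)" using prime_nth_prime[of i] by simp
    then show False using prime_product by fastforce
  qed
  ultimately show ?thesis by linarith
qed

lemma primorial_le_prod_primes:
  assumes "finite P" "\<And>p. p \<in> P \<Longrightarrow> prime p"
  shows "primorial (card P) \<le> \<Prod>P"
  unfolding primorial_def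
  using prod_enumerate_le[OF infinite_primes, of "\<lambda>p. p" P] assms by auto

lemma prod_prime_factors_dvd:
  fixes n :: nat
  assumes "n > 0"
  shows "\<Prod>(prime_factors n) dvd n"
proof -
  have "(\<Prod>p\<in>prime_factors n. p) dvd (\<Prod>p\<in>prime_factors n. p ^ multiplicity p n)"
    by (rule prod_dvd_prod) (auto simp: prime_factors_multiplicity intro: dvd_power)
  then show ?thesis using assms by (simp add: prime_factorization_nat[symmetric])
qed

text \<open>For even \<open>n\<close>, divisibility by 4 makes twice the product of the prime
  factors a divisor of \<open>n\<close>. For odd \<open>n\<close>, adjoining 2 gives a set of
  \<open>k + 1\<close> primes, whence \<open>5 * primorial k \<le> 2 * n\<close>.\<close>

lemma two_primorial_le:
  fixes n :: nat
  assumes "k > 1" "n > 0" "\<not> [n = 2] (mod 4)" "prime_omega n = k"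
  shows "2 * primorial k \<le> n"
proof -
  define P where "P = prime_factors n"
  have card: "finite P" "card P = k" and prime: "\<And>p. p \<in> P \<Longrightarrow> prime p"
    using assms(4) by (auto simp: P_def prime_omega_def)
  have dvd: "\<Prod>P dvd n" using prod_prime_factors_dvd assms(2) by (simp add: P_def)
  show ?thesis
  proof (cases "even n")
    case True
    then have two: "2 \<in> P" using assms(2) by (simp add: P_def in_prime_factors_iff)
    have "n mod 4 \<noteq> 2" using assms(3) by (simp add: cong_def)
    then have "4 dvd n" using True by presburger
    have "2 * \<Prod>P dvd n"
    proof -
      obtain m where m: "n = \<Prod>P * m" using dvd by (auto simp: dvd_def)
      \<comment> \<open>The product of all prime factors is thus divisible by 2 only once, so
        divisibility of \<open>n\<close> by 4 forces the cofactor \<open>m\<close> to be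
        even.\<close>
      have "odd (\<Prod>(P - {2}))"
      proof
        assume "even (\<Prod>(P - {2}))"
        then obtain p where "p \<in> P - {2}" "2 dvd p"
          using card prime_dvd_prod_iff[of "P - {2}" 2 "\<lambda>p. p"] by auto
        then show False using prime primes_dvd_imp_eq[of 2 p] by auto
      qed
      moreover have "\<Prod>P = 2 * \<Prod>(P - {2})" using card two by (simp add: prod.remove)
      ultimately have "even m" using \<open>4 dvd n\<close> m by (auto elim!: dvdE)
      then show ?thesis using m by auto
    qed
    then have "2 * \<Prod>P \<le> n" using assms(2) by (rule dvd_imp_le)
    then show ?thesis using primorial_le_prod_primes[of P] card prime by simp
  next
    case False
    then have two: "2 \<notin> P" by (auto simp: P_def)
    have "5 * primorial k \<le> primorial (Suc k)"
      using nth_prime_ge_5[of k] assms(1) by (simp add: primorial_def mult.commute)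
    also have "\<dots> \<le> \<Prod>(insert 2 P)"
      using primorial_le_prod_primes[of "insert 2 P"] card two prime two_is_prime_nat by fastforce
    also have "\<dots> = 2 * \<Prod>P" using card two by simp
    also have "\<dots> \<le> 2 * n" using dvd_imp_le[OF dvd assms(2)] by simp
    finally show ?thesis by simp
  qed
qed

section \<open>Lower bounds for the local densities\<close>

text \<open>On the primes this is monotone, the values at 2 and 3 both being 1/2.\<close>
definition min_density :: "nat \<Rightarrow> real" where
  "min_density p = (if p = 2 then 1 / 2 else 1 - 1 / (real p - 1))"

text \<open>The general formula increases, and the exceptional value 1/2 at 2 does not exceed its
  values from 3 onwards.\<close>

lemma min_density_mono:
  assumes "prime p" "p \<le> q"
  shows "min_density p \<le> min_density q"
proof -
  have "p \<ge> 2" using assms(1) by (rule prime_ge_2_nat)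
  then have "1 / (real q - 1) \<le> 1 / (real p - 1)"
    using assms(2) by (intro frac_le) auto
  moreover have "1 / (real q - 1) \<le> 1 / 2" if "q \<noteq> 2"
    using that \<open>p \<ge> 2\<close> assms(2) by (intro frac_le) auto
  ultimately show ?thesis using \<open>p \<ge> 2\<close> assms(2) by (auto simp: min_density_def)
qed

lemma min_density_nonneg: "prime p \<Longrightarrow> 0 \<le> min_density p"
  using min_density_mono[of 2 p] prime_ge_2_nat[of p] by (simp add: min_density_def)

text \<open>At 2 the congruence hypothesis forces 4 to divide \<open>n\<close>, giving equality. At
  odd \<open>p\<close> the smaller branch of the local density is the bound.\<close>

lemma min_density_le_local_density:
  assumes "prime p" "p dvd n" "\<not> [n = 2] (mod 4)"
  shows "min_density p \<le> local_density n p"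
proof (cases "p = 2")
  case True
  have "n mod 4 \<noteq> 2" using assms(3) by (simp add: cong_def)
  then have "4 dvd n" using True assms(2) by presburger
  then show ?thesis using True by (simp add: local_density_def min_density_def)
next
  case False
  have "p \<ge> 2" using assms(1) by (rule prime_ge_2_nat)
  then show ?thesis using False by (auto simp: local_density_def min_density_def field_simps)
qed

text \<open>The prime factors are the first \<open>k\<close> primes, and 2 is the only one whose
  square divides, so every local bound is attained.\<close>

lemma primitive_proportion_two_primorial:
  assumes "k > 0"
  shows "primitive_proportion (2 * primorial k) = (\<Prod>i<k. min_density (nth_prime i))"
proof -
  define P where "P = nth_prime ` {..<k}"
  have inj: "inj_on nth_prime {..<k}"
    using inj_enumerate[OF infinite_primes] by (rule inj_on_subset) simp
  have prime: "prime p" if "p \<in> P" for p using that prime_nth_prime by (auto simp: P_def)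
  have "2 \<in> P" using assms nth_prime_0 by (force simp: P_def)
  have prim: "primorial k = \<Prod>P" by (simp add: primorial_def P_def prod.reindex[OF inj])
  have fin: "finite P" by (simp add: P_def)
  have pos: "\<Prod>P > 0" by (intro prod_pos) (auto intro: prime_gt_0_nat prime)
  have factors: "prime_factors (2 * \<Prod>P) = P"
  proof (intro equalityI subsetI)
    fix p assume "p \<in> prime_factors (2 * \<Prod>P)"
    then have p: "prime p" "p dvd 2 \<or> p dvd \<Prod>P" by (auto simp: in_prime_factors_iff prime_dvd_mult_iff)
    then obtain q where q: "q \<in> P" "p dvd q"
      using \<open>2 \<in> P\<close> fin by (auto simp: prime_dvd_prod_iff)
    then show "p \<in> P" using prime p(1) primes_dvd_imp_eq by blast
  next
    fix p assume p: "p \<in> P"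
    then have "p dvd 2 * \<Prod>P" using fin by (intro dvd_mult) (rule dvd_prodI)
    then show "p \<in> prime_factors (2 * \<Prod>P)" using p prime pos by (simp add: in_prime_factors_iff)
  qed
  have "local_density (2 * \<Prod>P) p = min_density p" if p: "p \<in> P" for p
  proof -
    have split: "\<Prod>P = p * \<Prod>(P - {p})" using p fin by (simp add: prod.remove)
    have "p\<^sup>2 dvd 2 * \<Prod>P \<longleftrightarrow> p = 2"
    proof
      assume "p\<^sup>2 dvd 2 * \<Prod>P"
      then have "p * p dvd p * (2 * \<Prod>(P - {p}))" by (simp add: split power2_eq_square mult_ac)
      then have "p dvd 2 * \<Prod>(P - {p})" using prime_gt_0_nat[OF prime[OF p]] by simp
      moreover have "\<not> p dvd \<Prod>(P - {p})"
      proof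
        assume "p dvd \<Prod>(P - {p})"
        then obtain q where "q \<in> P - {p}" "p dvd q"
          using fin prime[OF p] prime_dvd_prod_iff[of "P - {p}" p "\<lambda>q. q"] by auto
        then show False using prime[OF p] prime primes_dvd_imp_eq by blast
      qed
      ultimately have "p dvd 2" using prime[OF p] prime_dvd_mult_iff by blast
      then show "p = 2" using prime[OF p] primes_dvd_imp_eq two_is_prime_nat by blast
    qed (simp add: split power2_eq_square)
    then show ?thesis by (simp add: local_density_def min_density_def)
  qed
  then have "(\<Prod>p\<in>P. local_density (2 * \<Prod>P) p) = (\<Prod>p\<in>P. min_density p)"
    by (rule prod.cong[OF refl])
  also have "\<dots> = (\<Prod>i<k. min_density (nth_prime i))"
    by (simp add: P_def prod.reindex[OF inj])
  finally show ?thesis using pos by (simp add: prim primitive_proportion_eq factors)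
qed

theorem mainTheorem3:
  fixes k n :: nat
  assumes "k > 1"
    and "\<not> [n = 2] (mod 4)"
    and "prime_omega n = k"
  shows "primitive_proportion (2 * primorial k) * ln (ln (real (2 * primorial k)))
           \<le> primitive_proportion n * ln (ln (real n))"
proof -
  \<comment> \<open>The prime factors of 0 form the empty set, so \<open>n = 0\<close> would give
    \<open>k = 0\<close>.\<close>
  have n: "n > 0" using assms(1,3) by (auto simp: prime_omega_def intro: Nat.gr0I)
  have density: "primitive_proportion (2 * primorial k) \<le> primitive_proportion n"
  proof -
    have "primitive_proportion (2 * primorial k) = (\<Prod>i<k. min_density (nth_prime i))"
      using assms(1) by (simp add: primitive_proportion_two_primorial)
    also have "\<dots> \<le> (\<Prod>p\<in>prime_factors n. min_density p)"
      using assms(3) min_density_mono min_density_nonneg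
      by (intro prod_enumerate_le[OF infinite_primes]) (auto simp: prime_omega_def)
    also have "\<dots> \<le> (\<Prod>p\<in>prime_factors n. local_density n p)"
      using assms(2) by (intro prod_mono) (auto simp: min_density_nonneg min_density_le_local_density in_prime_factors_iff)
    finally show ?thesis using n by (simp add: primitive_proportion_eq)
  qed
  have "primorial k > 0"
    unfolding primorial_def by (intro prod_pos) (simp add: prime_nth_prime prime_gt_0_nat)
  moreover have "primorial 2 dvd primorial k"
    unfolding primorial_def using assms(1) by (intro prod_dvd_prod_subset) auto
  ultimately have "primorial 2 \<le> primorial k" by (intro dvd_imp_le)
  moreover have "primorial 2 = 6"
    by (simp add: primorial_def nth_prime_0 nth_prime_1 numeral_2_eq_2 del: enumerate_0 enumerate_Suc)
  \<comment> \<open>As 12 exceeds \<open>exp 1\<close>, the inner logarithm is at least 1 and the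
    iterated one nonnegative, so the two inequalities can be multiplied.\<close>
  ultimately have ge: "real (2 * primorial k) \<ge> 12" by simp
  have "exp 1 \<le> real (2 * primorial k)" using exp_le ge by linarith
  then have "1 \<le> ln (real (2 * primorial k))" using ge by (subst ln_ge_iff) auto
  moreover have "ln (real (2 * primorial k)) \<le> ln (real n)"
    using two_primorial_le[OF assms(1) n assms(2,3)] ge by (subst ln_le_cancel_iff) auto
  ultimately have "ln (ln (real (2 * primorial k))) \<le> ln (ln (real n))" "0 \<le> ln (ln (real (2 * primorial k)))"
    by auto
  moreover have "0 \<le> primitive_proportion n" by (simp add: primitive_proportion_def)
  ultimately show ?thesis using density by (intro mult_mono) auto
qed

end
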